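(* Let $H$ be a real Hilbert space, $C\subset H$ a nonempty closed convex set, and $f:C\times C\to\mathbb{R}$ a bifunction with $f(x,x)=0$ for all $x\in C$, such that for every $x\in C$ the function $f(x,\cdot)$ is convex and lower semicontinuous on $C$, and for every $y\in C$ the function $f(\cdot,y)$ is hemicontinuous on $C$. Assume: (i) (strong pseudomonotonicity) there exists $\gamma>0$ such that for all $x,y\in C$, $f(x,y)\ge 0$ implies $f(y,x)\le -\gamma\|x-y\|^2$; (ii) (Lipschitz-type condition) $c_1>0$, $c_2>0$ are constants such that $f(x,y)+f(y,z)\ge f(x,z)-c_1\|x-y\|^2-c_2\|y-z\|^2$ for all $x,y,z\in C$. Let $\varphi=\frac{\sqrt5+1}{2}$, let $\bar{x}_0\in H$, $x_1\in C$, and let $\lambda\in\mathbb{R}$ satisfy $0<\lambda<\frac{\varphi}{4\max\{c_1,c_2\}}$. Define, for $n\ge 1$, $$\bar{x}_n=\frac{(\varphi-1)x_n+\bar{x}_{n-1}}{\varphi},\qquad x_{n+1}=\mathrm{prox}_{\lambda f(x_n,\cdot)}(\bar{x}_n).$$ Then the sequence $\{x_n\}$ converges $R$-linearly to the unique solution $x^\dagger$ of the equilibrium problem: find $x^*\in C$ such that $f(x^*,y)\ge 0$ for all $y\in C$.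
   Context: For a proper, lower semicontinuous, convex function $g:C\to\mathbb{R}$ and $\lambda>0$, the proximal operator is $$\mathrm{prox}_{\lambda g}(z)=\arg\min\left\{\lambda g(x)+\tfrac12\|x-z\|^2:\ x\in C\right\},\qquad z\in H,$$ so $x_{n+1}$ is the unique minimizer over $y\in C$ of $\lambda f(x_n,y)+\frac12\|y-\bar{x}_n\|^2$. A function $h:C\to\mathbb{R}$ is hemicontinuous on $C$ if it is continuous along line segments in $C$, i.e. for all $u,v\in C$ the map $t\mapsto h(u+t(v-u))$ is continuous on $[0,1]$. Under the stated assumptions the equilibrium problem has a unique solution, denoted $x^\dagger$. A sequence $\{x_n\}$ converges $R$-linearly to $x^\dagger$ if there exist constants $M>0$ and $\theta\in(0,1)$ such that $\|x_n-x^\dagger\|\le M\theta^n$ for all $n\ge1$. *)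

theory Defs
  imports "HOL-Analysis.Analysis"
begin

definition lower_semicontinuous_on :: "'a::topological_space set \<Rightarrow> ('a \<Rightarrow> real) \<Rightarrow> bool" where
  "lower_semicontinuous_on S h \<longleftrightarrow>
     (\<forall>x\<in>S. \<forall>a < h x. eventually (\<lambda>y. a < h y) (at x within S))"

definition hemicontinuous_on :: "'a::real_normed_vector set \<Rightarrow> ('a \<Rightarrow> real) \<Rightarrow> bool" where
  "hemicontinuous_on S h \<longleftrightarrow>
     (\<forall>u\<in>S. \<forall>v\<in>S. continuous_on {0..1::real} (\<lambda>t. h (u + t *\<^sub>R (v - u))))"

text \<open>
  \<open>arg_min_on\<close> picks an arbitrary minimizer.  For \<open>lam > 0\<close> and \<open>g\<close> convex and lower
  semicontinuous on a nonempty closed convex set \<open>C\<close> of a Hilbert space the minimizer exists and is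
  unique, so the choice is immaterial.  Values of \<open>g\<close> outside \<open>C\<close> are not used.
\<close>
definition prox :: "'a::real_inner set \<Rightarrow> real \<Rightarrow> ('a \<Rightarrow> real) \<Rightarrow> 'a \<Rightarrow> 'a" where
  "prox C lam g z = arg_min_on (\<lambda>x. lam * g x + 1 / 2 * (norm (x - z))\<^sup>2) C"

definition equilibrium_solution :: "'a set \<Rightarrow> ('a \<Rightarrow> 'a \<Rightarrow> real) \<Rightarrow> 'a \<Rightarrow> bool" where
  "equilibrium_solution C f x \<longleftrightarrow> x \<in> C \<and> (\<forall>y\<in>C. f x y \<ge> 0)"

text \<open>Sequences are indexed from 1; the term with index 0 is irrelevant.\<close>
definition converges_R_linearly :: "(nat \<Rightarrow> 'a::real_normed_vector) \<Rightarrow> 'a \<Rightarrow> bool" where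
  "converges_R_linearly x l \<longleftrightarrow>
     (\<exists>M>0. \<exists>\<theta>::real. 0 < \<theta> \<and> \<theta> < 1 \<and> (\<forall>n\<ge>1. norm (x n - l) \<le> M * \<theta> ^ n))"

definition golden_ratio :: real where
  "golden_ratio = (sqrt 5 + 1) / 2"

end

theory Submission
  imports Defs
begin

text \<open>
  \<^bold>\<open>Existence of a solution.\<close> For \<open>y \<in> C\<close> put
  \<open>M y = {x \<in> C. f y x + \<gamma> * (norm (x - y))\<^sup>2 \<le> 0}\<close>.
  The quadratic term, which strong pseudomonotonicity provides, makes these closed convex sets
  bounded, because a convex lower semicontinuous function decreases at most linearly
  (\<open>convex_lsc_linear_minorant\<close>). If a convex combination \<open>x\<close> of points \<open>y\<close> avoided all the
  sets \<open>M y\<close>, strong pseudomonotonicity would give \<open>f x y < 0\<close> for each of them, and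
  convexity of \<open>f x\<close> would give \<open>f x x < 0\<close>; so the \<open>M y\<close> satisfy the
  Knaster-Kuratowski-Mazurkiewicz condition and any finitely many of them meet. For closed
  \<^emph>\<open>convex\<close> sets that conclusion has an elementary proof by separation and induction
  (\<open>Klee_convex_cover\<close>, \<open>KKM_closed_convex\<close>). In a Hilbert space
  bounded closed convex sets with the finite intersection property have a common point
  (\<open>closed_convex_fip\<close>), and a common point of the \<open>M y\<close> satisfies Minty's inequality
  \<open>f y x \<le> 0\<close>, which hemicontinuity turns into \<open>f x y \<ge> 0\<close> (\<open>Minty_equilibrium\<close>).
  The same intersection principle, applied to sublevel sets, shows that the proximal points exist.

  \<^bold>\<open>Convergence.\<close> Let \<open>p\<close> be the solution, \<open>\<phi>\<close> the golden ratio, \<open>c = max c1 c2\<close>, and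
  \<open>\<kappa> = 2 * lam * c\<close>. The variational inequalities of two consecutive proximal steps,
  the Lipschitz-type condition and strong pseudomonotonicity combine to
  \<open>(\<phi> + 1) |xbar (n+1) - p|\<^sup>2 + (\<phi> - \<kappa>) |x (n+1) - x n|\<^sup>2 + \<phi> |x n - xbar n|\<^sup>2 + 2 lam \<gamma> |x n - p|\<^sup>2
    \<le> (\<phi> + 1) |xbar n - p|\<^sup>2 + \<kappa> |x n - x (n-1)|\<^sup>2\<close>
  (\<open>golden_ratio_energy_inequality\<close>); the equation \<open>\<phi>\<^sup>2 = \<phi> + 1\<close> is what makes the
  terms \<open>|x (n+1) - xbar n|\<^sup>2\<close> cancel. The bound on \<open>lam\<close> says \<open>\<kappa> < \<phi> - \<kappa>\<close>, so the
  coefficient of the increments shrinks from the left to the right, and the last two terms on the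
  left dominate a fixed fraction of \<open>|xbar n - p|\<^sup>2\<close>. Hence the energy
  \<open>(\<phi> + 1) |xbar n - p|\<^sup>2 + (\<phi> - \<kappa>) |x n - x (n-1)|\<^sup>2\<close> decreases geometrically, and it bounds a
  multiple of \<open>|x n - p|\<^sup>2\<close>.
\<close>

section \<open>Intersections of closed convex sets in a Hilbert space\<close>

text \<open>
The quantitative form of strict convexity of the squared norm. It is an identity in \<open>t\<close>; with
\<open>t = 1 / 2\<close> it is the parallelogram law.
\<close>
lemma norm_sq_affine_comb:
  fixes a b :: "'a::real_inner"
  shows "(norm ((1 - t) *\<^sub>R a + t *\<^sub>R b))\<^sup>2
    = (1 - t) * (norm a)\<^sup>2 + t * (norm b)\<^sup>2 - t * (1 - t) * (norm (a - b))\<^sup>2"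
  unfolding power2_norm_eq_inner
  by (simp add: inner_simps inner_commute[of b a]) (simp add: algebra_simps)

text \<open>
This replaces weak compactness. Let \<open>d \<G>\<close> be the distance from the origin to the intersection
of a finite subfamily \<open>\<G>\<close>, and \<open>D\<close> the supremum of these distances, which is finite because
of the bounded member. If \<open>d \<G>\<close> is close to \<open>D\<close>, then the part of \<open>\<Inter>\<G>\<close> within distance
slightly more than \<open>D\<close> has small diameter, since by the parallelogram law the midpoint of two distant
points would come closer to the origin than \<open>d \<G>\<close>. So these truncated intersections have the
finite intersection property and contain arbitrarily small sets, and Cantor's intersection theorem
for complete metric spaces applies.
\<close>
lemma closed_convex_fip:
  fixes \<F> :: "'a::{real_inner, complete_space} set set"
  assumes clcv: "\<And>S. S \<in> \<F> \<Longrightarrow> closed S \<and> convex S"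
    and B: "B \<in> \<F>" "bounded B"
    and fip: "\<And>\<G>. finite \<G> \<Longrightarrow> \<G> \<subseteq> \<F> \<Longrightarrow> \<Inter>\<G> \<noteq> {}"
  shows "\<Inter>\<F> \<noteq> {}"
proof -
  define \<A> where "\<A> = {\<G>. finite \<G> \<and> \<G> \<subseteq> \<F> \<and> B \<in> \<G>}"
  define d where "d \<G> = Inf (norm ` \<Inter>\<G>)" for \<G> :: "'a set set"
  define D where "D = Sup (d ` \<A>)"
  define \<C> where "\<C> = {\<Inter>\<G> \<inter> cball 0 (D + \<delta>) |\<G> \<delta>. \<G> \<in> \<A> \<and> \<delta> > 0}"
  have ne: "\<Inter>\<G> \<noteq> {}" if "\<G> \<in> \<A>" for \<G>
    using fip that by (auto simp: \<A>_def)
  have d_le: "d \<G> \<le> norm x" if "x \<in> \<Inter>\<G>" for \<G> x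
    unfolding d_def using that by (intro cINF_lower) (auto intro: bdd_belowI[of _ 0])
  obtain R where R: "\<And>x. x \<in> B \<Longrightarrow> norm x \<le> R"
    using B(2) by (auto simp: bounded_iff)
  have bdd: "bdd_above (d ` \<A>)"
  proof (rule bdd_aboveI[of _ R])
    fix r assume "r \<in> d ` \<A>"
    then obtain \<G> where \<G>: "\<G> \<in> \<A>" "r = d \<G>" by auto
    from ne[OF \<G>(1)] obtain x where "x \<in> \<Inter>\<G>" by auto
    with \<G> d_le[of x \<G>] R[of x] show "r \<le> R" by (fastforce simp: \<A>_def)
  qed
  have d_D: "d \<G> \<le> D" if "\<G> \<in> \<A>" for \<G>
    unfolding D_def using bdd that by (intro cSUP_upper) auto
  have A0: "{B} \<in> \<A>" using B by (auto simp: \<A>_def)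
  have "0 \<le> d {B}"
    unfolding d_def using ne[OF A0] by (intro cINF_greatest) auto
  then have D0: "D \<ge> 0" using d_D[OF A0] by linarith
  have C_ne: "\<Inter>\<G> \<inter> cball 0 (D + \<delta>) \<noteq> {}" if "\<G> \<in> \<A>" "\<delta> > 0" for \<G> \<delta>
  proof -
    have "Inf (norm ` \<Inter>\<G>) < D + \<delta>" using d_D[OF that(1)] that(2) by (simp add: d_def)
    moreover have "norm ` \<Inter>\<G> \<noteq> {}" using ne[OF that(1)] by blast
    ultimately obtain r where "r \<in> norm ` \<Inter>\<G>" "r < D + \<delta>" by (meson cInf_lessD)
    then obtain x where "x \<in> \<Inter>\<G>" "norm x < D + \<delta>" by blast
    then show ?thesis by (auto simp: disjoint_iff)
  qed
  \<comment> \<open>\<open>\<C>\<close> is a filter base: the witness is the union of the subfamilies, cut off at the smallest radius.\<close>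
  have lower: "\<exists>\<G>\<in>\<A>. \<exists>\<delta>>0. \<Inter>\<G> \<inter> cball 0 (D + \<delta>) \<subseteq> \<Inter>\<K>" if "finite \<K>" "\<K> \<subseteq> \<C>" for \<K>
    using that
  proof (induction \<K>)
    case empty
    show ?case using A0 by (intro bexI[of _ "{B}"] exI[of _ 1]) auto
  next
    case (insert K \<K>)
    then obtain \<G> \<delta> where 1: "\<G> \<in> \<A>" "\<delta> > 0" "\<Inter>\<G> \<inter> cball 0 (D + \<delta>) \<subseteq> \<Inter>\<K>" by auto
    from insert obtain \<G>' \<delta>' where 2: "\<G>' \<in> \<A>" "\<delta>' > 0" "K = \<Inter>\<G>' \<inter> cball 0 (D + \<delta>')"
      by (auto simp: \<C>_def)
    have "\<Inter>(\<G> \<union> \<G>') \<inter> cball 0 (D + min \<delta> \<delta>') \<subseteq> \<Inter>(insert K \<K>)"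
      using 1(3) 2(3) by (auto simp: subset_iff)
    moreover have "\<G> \<union> \<G>' \<in> \<A>" using 1 2 by (auto simp: \<A>_def)
    ultimately show ?case using 1(2) 2(2)
      by (intro bexI[of _ "\<G> \<union> \<G>'"] exI[of _ "min \<delta> \<delta>'"]) auto
  qed
  have small: "\<exists>K a. K \<in> \<C> \<and> K \<subseteq> cball a e" if "e > 0" for e
  proof -
    \<comment> \<open>Two points of norm at most \<open>D + \<delta>\<close> whose midpoint has norm above \<open>D - \<delta>\<close> have squared
      distance at most \<open>16 * \<delta> * (D + \<delta>)\<close>.\<close>
    define \<delta> where "\<delta> = min 1 (e\<^sup>2 / (16 * (D + 1)))"
    have \<delta>: "\<delta> > 0" "\<delta> \<le> 1" "16 * \<delta> * (D + 1) \<le> e\<^sup>2"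
    proof -
      have "\<delta> \<le> e\<^sup>2 / (16 * (D + 1))" by (simp add: \<delta>_def)
      then show "16 * \<delta> * (D + 1) \<le> e\<^sup>2" using D0 by (simp add: field_simps)
    qed (use that D0 in \<open>auto simp: \<delta>_def\<close>)
    have "D - \<delta> < Sup (d ` \<A>)" using \<delta> by (simp add: D_def)
    then obtain \<G> where \<G>: "\<G> \<in> \<A>" "D - \<delta> < d \<G>"
      using less_cSupD[of "d ` \<A>" "D - \<delta>"] A0 by blast
    define K where "K = \<Inter>\<G> \<inter> cball 0 (D + \<delta>)"
    have K: "K \<in> \<C>" unfolding \<C>_def K_def using \<G>(1) \<delta>(1) by blast
    have conv: "convex K"
      unfolding K_def using clcv \<G>(1)
      by (intro convex_Int convex_Inter convex_cball) (auto simp: \<A>_def)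
    have "dist a b \<le> e" if ab: "a \<in> K" "b \<in> K" for a b
    proof -
      define m where "m = (1 - 1/2) *\<^sub>R a + (1/2::real) *\<^sub>R b"
      have mK: "m \<in> K"
        unfolding m_def using conv ab convexD_alt[of K a b "1/2"] by simp
      have m: "norm m > D - \<delta>" "norm m \<le> D + \<delta>"
        using mK d_le[of m \<G>] \<G>(2) by (auto simp: K_def)
      have "(D + \<delta>)\<^sup>2 - (norm m)\<^sup>2 = (D + \<delta> - norm m) * (D + \<delta> + norm m)"
        by (simp add: power2_eq_square algebra_simps)
      also have "\<dots> \<le> (2 * \<delta>) * (2 * (D + \<delta>))"
        using m D0 \<delta> by (intro mult_mono) auto
      also have "\<dots> \<le> (2 * \<delta>) * (2 * (D + 1))"
        using \<delta> by (intro mult_left_mono) auto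
      finally have gap: "(D + \<delta>)\<^sup>2 - (norm m)\<^sup>2 \<le> e\<^sup>2 / 4" using \<delta>(3) by (simp add: algebra_simps)
      have "(norm a)\<^sup>2 \<le> (D + \<delta>)\<^sup>2" "(norm b)\<^sup>2 \<le> (D + \<delta>)\<^sup>2"
        using ab by (auto simp: K_def intro!: power_mono)
      moreover have "(norm m)\<^sup>2 = (norm a)\<^sup>2 / 2 + (norm b)\<^sup>2 / 2 - (norm (a - b))\<^sup>2 / 4"
        unfolding m_def norm_sq_affine_comb by simp
      ultimately have "(norm (a - b))\<^sup>2 \<le> e\<^sup>2" using gap by linarith
      then have "norm (a - b) \<le> e" by (rule power2_le_imp_le) (use \<open>e > 0\<close> in simp)
      then show ?thesis by (simp add: dist_norm)
    qed
    moreover obtain a where "a \<in> K"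
      using C_ne[OF \<G>(1) \<delta>(1)] unfolding K_def by blast
    ultimately have "K \<subseteq> cball a e" by auto
    with K show ?thesis by blast
  qed
  have "\<Inter>\<C> \<noteq> {}"
  proof -
    have "Met_TC.mcomplete TYPE('a)" using complete_UNIV by simp
    moreover have "closedin Met_TC.mtopology K" if "K \<in> \<C>" for K
      using that clcv by (auto simp: \<C>_def \<A>_def intro!: closed_Int closed_Inter)
    moreover have "\<Inter>\<K> \<noteq> {}" if fin: "finite \<K> \<and> \<K> \<subseteq> \<C>" for \<K>
    proof -
      obtain \<G> \<delta> where *: "\<G> \<in> \<A>" "\<delta> > 0" "\<Inter>\<G> \<inter> cball 0 (D + \<delta>) \<subseteq> \<Inter>\<K>"
        using lower[OF conjunct1[OF fin] conjunct2[OF fin]] by (elim bexE exE conjE)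
      show ?thesis
      proof
        assume "\<Inter>\<K> = {}"
        with *(3) have "\<Inter>\<G> \<inter> cball 0 (D + \<delta>) = {}" by simp
        with C_ne[OF *(1,2)] show False ..
      qed
    qed
    ultimately show ?thesis
      using small by (auto simp only: Met_TC.mcomplete_fip mcball_eq_cball)
  qed
  then obtain x where x: "x \<in> \<Inter>\<C>" by auto
  have "x \<in> S" if "S \<in> \<F>" for S
  proof -
    have "{B, S} \<in> \<A>" using that B by (auto simp: \<A>_def)
    then have "\<Inter>{B, S} \<inter> cball 0 (D + 1) \<in> \<C>"
      unfolding \<C>_def using zero_less_one by blast
    with x show ?thesis by auto
  qed
  then show ?thesis by auto
qed

section \<open>Convex lower semicontinuous functions and proximal points\<close>

text \<open>
Lower semicontinuity bounds \<open>g\<close> from below by \<open>g y - 1\<close> on a ball around \<open>y\<close>. A point far away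
cannot lie lower than linear extrapolation from that ball permits, since on the segment to \<open>y\<close>
convexity would push \<open>g\<close> below \<open>g y - 1\<close> inside the ball. This avoids the Hahn-Banach theorem.
\<close>
lemma convex_lsc_linear_minorant:
  fixes g :: "'a::real_normed_vector \<Rightarrow> real"
  assumes cv: "convex_on C g" and lsc: "lower_semicontinuous_on C g" and y: "y \<in> C"
  shows "\<exists>K>0. \<forall>x\<in>C. g y - K * (1 + norm (x - y)) \<le> g x"
proof -
  have "eventually (\<lambda>x. g y - 1 < g x) (at y within C)"
    using lsc y by (simp add: lower_semicontinuous_on_def)
  then obtain \<delta> where \<delta>: "\<delta> > 0" "\<And>x. x \<in> C \<Longrightarrow> dist x y < \<delta> \<Longrightarrow> g y - 1 < g x"
    unfolding eventually_at by (metis diff_less_eq less_add_one zero_less_dist_iff)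
  define K where "K = max 1 (2 / \<delta>)"
  have K: "K \<ge> 1" "K \<ge> 2 / \<delta>" by (auto simp: K_def)
  have "g y - K * (1 + norm (x - y)) \<le> g x" if x: "x \<in> C" for x
  proof (cases "norm (x - y) < \<delta>")
    case True
    have "1 \<le> K * (1 + norm (x - y))"
      using mult_mono[of 1 K 1 "1 + norm (x - y)"] K by simp
    then show ?thesis using \<delta>(2)[OF x] True by (simp add: dist_norm)
  next
    case False
    define r where "r = norm (x - y)"
    \<comment> \<open>The point at distance \<open>\<delta> / 2\<close> from \<open>y\<close> on the segment to \<open>x\<close>.\<close>
    define s where "s = \<delta> / (2 * r)"
    have r: "r \<ge> \<delta>" "r > 0" using False \<delta> by (auto simp: r_def)
    have s: "0 < s" "s \<le> 1" using r \<delta> by (auto simp: s_def field_simps)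
    let ?p = "(1 - s) *\<^sub>R y + s *\<^sub>R x"
    have "?p \<in> C"
      using cv x y s by (intro convexD_alt) (auto intro: convex_on_imp_convex)
    moreover have "dist ?p y < \<delta>"
    proof -
      have "?p - y = s *\<^sub>R (x - y)" by (simp add: algebra_simps)
      then have "dist ?p y = s * r" using s by (simp add: dist_norm r_def)
      also have "\<dots> = \<delta> / 2" using r by (simp add: s_def)
      finally show ?thesis using \<delta> by simp
    qed
    ultimately have "g y - 1 < g ?p" by (rule \<delta>(2))
    also have "\<dots> \<le> (1 - s) * g y + s * g x" using convex_onD[OF cv] s x y by simp
    finally have "s * (g y - g x) < 1" by (simp add: algebra_simps)
    then have "g y - g x < 1 / s" using s by (simp add: field_simps)
    also have "1 / s = (2 / \<delta>) * r" by (simp add: s_def)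
    also have "\<dots> \<le> K * (1 + r)" using K r \<delta> by (intro mult_mono) auto
    finally show ?thesis by (simp add: r_def)
  qed
  then show ?thesis using K(1) by (intro exI[of _ K]) auto
qed

lemma closed_lsc_perturbed_sublevel:
  fixes g q :: "'a::real_normed_vector \<Rightarrow> real"
  assumes C: "closed C" and lsc: "lower_semicontinuous_on C g" and q: "continuous_on UNIV q"
  shows "closed {x \<in> C. g x + q x \<le> a}"
  unfolding closed_sequential_limits
proof (intro allI impI, elim conjE)
  fix s l assume s: "\<forall>n. s n \<in> {x \<in> C. g x + q x \<le> a}" and lim: "s \<longlonglongrightarrow> l"
  have l: "l \<in> C" using C s lim by (auto intro: closed_sequentially)
  have "g l + q l \<le> a"
  proof (rule ccontr)
    assume "\<not> ?thesis"
    then obtain b where b: "a - q l < b" "b < g l"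
      using dense[of "a - q l" "g l"] by auto
    have "eventually (\<lambda>x. b < g x) (at l within C)"
      using lsc l b(2) by (simp add: lower_semicontinuous_on_def)
    then obtain U where U: "open U" "l \<in> U" "\<And>x. x \<in> U \<Longrightarrow> x \<in> C \<Longrightarrow> b < g x"
      unfolding eventually_at_topological using b(2) by metis
    have "eventually (\<lambda>n. s n \<in> U) sequentially"
      using lim U by (simp add: topological_tendstoD)
    moreover have "(\<lambda>n. a - q (s n)) \<longlonglongrightarrow> a - q l"
      using q lim by (intro tendsto_intros) (auto intro: continuous_on_tendsto_compose)
    then have "eventually (\<lambda>n. a - q (s n) < b) sequentially"
      using b(1) by (rule order_tendstoD)
    ultimately have "eventually (\<lambda>n. False) sequentially"
    proof eventually_elim
      case (elim n)
      have "s n \<in> C" "g (s n) + q (s n) \<le> a" using s by auto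
      with elim U(3)[of "s n"] show ?case by linarith
    qed
    then show False by simp
  qed
  with l show "l \<in> {x \<in> C. g x + q x \<le> a}" by simp
qed

text \<open>
Boundedness holds because \<open>g\<close> decreases at most linearly, so the quadratic term wins.
The sets occur with \<open>c = \<gamma>\<close> for the existence of an equilibrium and with
\<open>c = 1 / (2 * lam)\<close> for the existence of proximal points.
\<close>
lemma quadratically_perturbed_sublevel:
  fixes g :: "'a::real_inner \<Rightarrow> real" and z :: 'a and a :: real
  assumes C: "closed C" and cv: "convex_on C g" and lsc: "lower_semicontinuous_on C g"
    and c: "c > 0"
  defines "L \<equiv> {x \<in> C. g x + c * (norm (x - z))\<^sup>2 \<le> a}"
  shows "closed L" "convex L" "bounded L"
proof -
  show "closed L"
    unfolding L_def by (intro closed_lsc_perturbed_sublevel C lsc continuous_intros)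
  show "convex L"
    unfolding convex_alt
  proof (intro ballI allI impI)
    fix x y and t :: real assume x: "x \<in> L" and y: "y \<in> L" and t: "0 \<le> t \<and> t \<le> 1"
    let ?p = "(1 - t) *\<^sub>R x + t *\<^sub>R y"
    have "?p \<in> C"
      using cv x y t by (intro convexD_alt) (auto simp: L_def intro: convex_on_imp_convex)
    have "?p - z = (1 - t) *\<^sub>R (x - z) + t *\<^sub>R (y - z)" by (simp add: algebra_simps)
    then have "(norm (?p - z))\<^sup>2 \<le> (1 - t) * (norm (x - z))\<^sup>2 + t * (norm (y - z))\<^sup>2"
      using t by (simp add: norm_sq_affine_comb)
    then have "c * (norm (?p - z))\<^sup>2 \<le> c * ((1 - t) * (norm (x - z))\<^sup>2 + t * (norm (y - z))\<^sup>2)"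
      using c by simp
    moreover have "g ?p \<le> (1 - t) * g x + t * g y"
      using convex_onD[OF cv] x y t by (simp add: L_def)
    ultimately have "g ?p + c * (norm (?p - z))\<^sup>2
      \<le> (1 - t) * (g x + c * (norm (x - z))\<^sup>2) + t * (g y + c * (norm (y - z))\<^sup>2)"
      by (simp add: algebra_simps)
    also have "\<dots> \<le> (1 - t) * a + t * a"
      using x y t by (intro add_mono mult_left_mono) (auto simp: L_def)
    finally show "?p \<in> L" using \<open>?p \<in> C\<close> by (simp add: L_def algebra_simps)
  qed
  show "bounded L"
  proof (cases "C = {}")
    case False
    then obtain y where y: "y \<in> C" by auto
    obtain K where K: "K > 0" "\<And>x. x \<in> C \<Longrightarrow> g y - K * (1 + norm (x - y)) \<le> g x"
      using convex_lsc_linear_minorant[OF cv lsc y] by auto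
    define A where "A = \<bar>a - g y\<bar> + K * (1 + norm (z - y))"
    have A: "A \<ge> 0" using K by (simp add: A_def)
    have "norm (x - z) \<le> 1 + (A + K) / c" if x: "x \<in> L" for x
    proof (rule ccontr)
      define r where "r = norm (x - z)"
      assume "\<not> ?thesis"
      then have r: "r > 1 + (A + K) / c" by (simp add: r_def)
      have r1: "r > 1" using r A K c by (smt (verit) divide_nonneg_pos)
      have "norm (x - y) \<le> r + norm (z - y)"
        unfolding r_def using norm_triangle_ineq[of "x - z" "z - y"] by simp
      then have "K * norm (x - y) \<le> K * (r + norm (z - y))" using K by simp
      then have "c * r\<^sup>2 \<le> A + K * r"
        using K(2)[of x] x by (auto simp: L_def A_def r_def algebra_simps)
      also have "\<dots> \<le> A * r + K * r" using A r1 by (simp add: mult_le_cancel_left1)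
      finally have "(c * r) * r \<le> (A + K) * r" by (simp add: power2_eq_square algebra_simps)
      then have "c * r \<le> A + K" using r1 by simp
      then have "r \<le> (A + K) / c" using c by (simp add: field_simps)
      with r show False by simp
    qed
    then have "L \<subseteq> cball z (1 + (A + K) / c)" by (auto simp: dist_norm norm_minus_commute)
    then show ?thesis by (rule bounded_subset[OF bounded_cball])
  qed (simp add: L_def)
qed

text \<open>
A minimizer is a common point of the sublevel sets at the values attained on \<open>C\<close>. These form a
chain of nonempty bounded closed convex sets, so such a point exists; that the function is bounded
below is a consequence.
\<close>
lemma quadratically_perturbed_minimizer:
  fixes g :: "'a::{real_inner, complete_space} \<Rightarrow> real"
  assumes "C \<noteq> {}" and C: "closed C" and cv: "convex_on C g" and lsc: "lower_semicontinuous_on C g"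
    and c: "c > 0"
  shows "\<exists>p\<in>C. \<forall>y\<in>C. g p + c * (norm (p - z))\<^sup>2 \<le> g y + c * (norm (y - z))\<^sup>2"
proof -
  define \<Phi> where "\<Phi> x = g x + c * (norm (x - z))\<^sup>2" for x
  define L where "L u = {x \<in> C. \<Phi> x \<le> \<Phi> u}" for u
  note L = quadratically_perturbed_sublevel[OF C cv lsc c, of z, folded \<Phi>_def]
  have fip: "\<Inter>(L ` U) \<noteq> {}" if U: "finite U" "U \<subseteq> C" for U
  proof (cases "U = {}")
    case False
    then obtain u where "u \<in> U" "\<And>v. v \<in> U \<Longrightarrow> \<Phi> u \<le> \<Phi> v"
      using U(1) by (meson arg_min_if_finite(1) arg_min_least)
    then have "u \<in> \<Inter>(L ` U)" using U by (auto simp: L_def)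
    then show ?thesis by auto
  qed simp
  obtain u where u: "u \<in> C" using assms(1) by auto
  have "\<Inter>(L ` C) \<noteq> {}"
  proof (rule closed_convex_fip)
    show "L u \<in> L ` C" using u by simp
    show "bounded (L u)" unfolding L_def by (rule L)
    show "closed S \<and> convex S" if "S \<in> L ` C" for S
      using that L unfolding L_def by auto
    show "\<Inter>\<G> \<noteq> {}" if "finite \<G>" "\<G> \<subseteq> L ` C" for \<G>
      using finite_subset_image[OF that] fip by blast
  qed
  then obtain p where p: "\<And>y. y \<in> C \<Longrightarrow> p \<in> L y" by auto
  then have "p \<in> C" using u by (auto simp: L_def)
  with p show ?thesis by (auto simp: L_def \<Phi>_def)
qed

text \<open>
The second claim is the first-order optimality condition: compare the proximal point \<open>p\<close> with
\<open>(1 - t) *\<^sub>R p + t *\<^sub>R y\<close>, divide by \<open>t\<close> and let \<open>t\<close> tend to \<open>0\<close>.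
\<close>
lemma prox_in_and_variational_ineq:
  fixes g :: "'a::{real_inner, complete_space} \<Rightarrow> real"
  assumes "C \<noteq> {}" and C: "closed C" and cv: "convex_on C g" and lsc: "lower_semicontinuous_on C g"
    and lam: "lam > 0"
  shows "prox C lam g z \<in> C"
    and "\<And>y. y \<in> C \<Longrightarrow>
      inner (z - prox C lam g z) (y - prox C lam g z) \<le> lam * (g y - g (prox C lam g z))"
proof -
  define \<Phi> where "\<Phi> x = lam * g x + 1 / 2 * (norm (x - z))\<^sup>2" for x
  define p where "p = prox C lam g z"
  have "\<exists>q\<in>C. \<forall>y\<in>C. g q + (1 / (2 * lam)) * (norm (q - z))\<^sup>2 \<le> g y + (1 / (2 * lam)) * (norm (y - z))\<^sup>2"
    using assms by (intro quadratically_perturbed_minimizer) auto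
  then obtain q where q: "q \<in> C"
    "\<And>y. y \<in> C \<Longrightarrow> g q + (1 / (2 * lam)) * (norm (q - z))\<^sup>2 \<le> g y + (1 / (2 * lam)) * (norm (y - z))\<^sup>2"
    by auto
  have "\<Phi> q \<le> \<Phi> y" if "y \<in> C" for y
    using mult_left_mono[OF q(2)[OF that], of lam] lam by (simp add: \<Phi>_def distrib_left)
  then have "is_arg_min \<Phi> (\<lambda>x. x \<in> C) q"
    using q(1) by (auto simp: is_arg_min_linorder)
  then have "is_arg_min \<Phi> (\<lambda>x. x \<in> C) p"
    unfolding p_def prox_def arg_min_on_def arg_min_def \<Phi>_def by (rule someI)
  then have p: "p \<in> C" and min: "\<And>y. y \<in> C \<Longrightarrow> \<Phi> p \<le> \<Phi> y"
    by (auto simp: is_arg_min_linorder)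
  show "prox C lam g z \<in> C" using p by (simp add: p_def)
  fix y assume y: "y \<in> C"
  have step: "inner (z - p) (y - p) \<le> lam * (g y - g p) + t * (1 / 2 * (norm (p - y))\<^sup>2)"
    if t: "0 < t" "t \<le> 1" for t
  proof -
    let ?w = "(1 - t) *\<^sub>R p + t *\<^sub>R y"
    have "?w \<in> C"
      using cv p y t by (intro convexD_alt) (auto intro: convex_on_imp_convex)
    then have "\<Phi> p \<le> \<Phi> ?w" by (rule min)
    moreover have "lam * g ?w \<le> lam * ((1 - t) * g p + t * g y)"
      using convex_onD[OF cv] p y t lam by simp
    moreover have "?w - z = (1 - t) *\<^sub>R (p - z) + t *\<^sub>R (y - z)" by (simp add: algebra_simps)
    then have "(norm (?w - z))\<^sup>2
      = (1 - t) * (norm (p - z))\<^sup>2 + t * (norm (y - z))\<^sup>2 - t * (1 - t) * (norm (p - y))\<^sup>2"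
      by (simp add: norm_sq_affine_comb)
    ultimately have "t * (1 / 2 * ((norm (p - z))\<^sup>2 - (norm (y - z))\<^sup>2 + (1 - t) * (norm (p - y))\<^sup>2))
      \<le> t * (lam * (g y - g p))"
      unfolding \<Phi>_def by (simp add: algebra_simps)
    then have "1 / 2 * ((norm (p - z))\<^sup>2 - (norm (y - z))\<^sup>2 + (1 - t) * (norm (p - y))\<^sup>2)
      \<le> lam * (g y - g p)"
      using t by (simp only: mult_le_cancel_left_pos)
    moreover have "(norm (p - z))\<^sup>2 - (norm (y - z))\<^sup>2 + (norm (p - y))\<^sup>2 = 2 * inner (z - p) (y - p)"
      unfolding power2_norm_eq_inner by (simp add: inner_simps inner_commute)
    ultimately show ?thesis by (simp add: algebra_simps)
  qed
  have "((\<lambda>t. lam * (g y - g p) + t * (1 / 2 * (norm (p - y))\<^sup>2))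
      \<longlongrightarrow> lam * (g y - g p) + 0 * (1 / 2 * (norm (p - y))\<^sup>2)) (at_right 0)"
    by (intro tendsto_intros)
  moreover have "eventually (\<lambda>t. inner (z - p) (y - p)
      \<le> lam * (g y - g p) + t * (1 / 2 * (norm (p - y))\<^sup>2)) (at_right (0::real))"
    unfolding eventually_at_right_field using step by (intro exI[of _ 1]) auto
  ultimately have "inner (z - p) (y - p) \<le> lam * (g y - g p) + 0 * (1 / 2 * (norm (p - y))\<^sup>2)"
    by (rule tendsto_lowerbound) simp
  then show "inner (z - prox C lam g z) (y - prox C lam g z) \<le> lam * (g y - g (prox C lam g z))"
    by (simp add: p_def)
qed


section \<open>A Knaster-Kuratowski-Mazurkiewicz theorem for convex sets\<close>

text \<open>
The hyperplane that bisects a shortest segment between the two sets; compactness of both provides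
that segment in any inner product space, whatever its dimension.
\<close>
lemma compact_convex_strict_separation:
  fixes S T :: "'a::real_inner set"
  assumes "compact S" "convex S" "S \<noteq> {}" "compact T" "convex T" "T \<noteq> {}" "S \<inter> T = {}"
  shows "\<exists>a b. (\<forall>x\<in>S. inner a x < b) \<and> (\<forall>x\<in>T. b < inner a x)"
proof -
  have "\<exists>u\<in>S \<times> T. \<forall>v\<in>S \<times> T. dist (fst u) (snd u) \<le> dist (fst v) (snd v)"
    using assms by (intro continuous_attains_inf compact_Times continuous_intros) auto
  then obtain s t where st: "s \<in> S" "t \<in> T"
    and min: "\<And>x y. x \<in> S \<Longrightarrow> y \<in> T \<Longrightarrow> dist s t \<le> dist x y"
    by fastforce
  define a where "a = t - s"
  define b where "b = (inner a s + inner a t) / 2"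
  have "a \<noteq> 0" using st assms(7) by (auto simp: a_def)
  then have "inner a t - inner a s > 0"
    by (metis a_def inner_diff_right inner_gt_zero_iff)
  moreover have "inner a x \<le> inner a s" if "x \<in> S" for x
  proof -
    have "inner (t - s) (x - s) \<le> 0"
      using assms st that min by (intro any_closest_point_dot[of S]) (auto simp: compact_imp_closed dist_commute)
    then show ?thesis by (simp add: a_def inner_simps)
  qed
  moreover have "inner a t \<le> inner a x" if "x \<in> T" for x
  proof -
    have "inner (s - t) (x - t) \<le> 0"
      using assms st that min by (intro any_closest_point_dot[of T]) (auto simp: compact_imp_closed)
    then show ?thesis by (simp add: a_def inner_simps)
  qed
  ultimately have "(\<forall>x\<in>S. inner a x < b) \<and> (\<forall>x\<in>T. b < inner a x)"
    unfolding b_def by (fastforce simp: field_simps)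
  then show ?thesis by blast
qed

text \<open>
Suppose that the sets \<open>A i\<close> have no common point in \<open>S\<close>. Then \<open>A n\<close> and the intersection \<open>K\<close> of the others are
strictly separated within \<open>S\<close> by a hyperplane. On the slice of \<open>S\<close> by this hyperplane the
other sets still form a cover, and still all but any one of them meet: a point of \<open>A n\<close> and a point of \<open>K\<close>
that both lie in these sets are joined by a segment crossing the hyperplane. By induction the
slice contains a point of \<open>K\<close>, which the hyperplane avoids.
\<close>
lemma Klee_convex_cover:
  fixes A :: "'i \<Rightarrow> 'a::real_inner set"
  assumes "finite I" "I \<noteq> {}"
    and "\<And>i. i \<in> I \<Longrightarrow> closed (A i) \<and> convex (A i)"
    and "compact S" "convex S" "S \<subseteq> (\<Union>i\<in>I. A i)"
    and "\<And>j. j \<in> I \<Longrightarrow> S \<inter> (\<Inter>i\<in>I - {j}. A i) \<noteq> {}"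
  shows "S \<inter> (\<Inter>i\<in>I. A i) \<noteq> {}"
  using assms
proof (induction I arbitrary: S rule: finite_ne_induct)
  case (singleton i)
  then show ?case by fastforce
next
  case (insert n I)
  show ?case
  proof
    assume empty: "S \<inter> (\<Inter>i\<in>insert n I. A i) = {}"
    define K where "K = S \<inter> (\<Inter>i\<in>I. A i)"
    have "\<exists>z. z \<in> S \<and> (\<forall>i\<in>insert n I - {j}. z \<in> A i)" if "j \<in> insert n I" for j
      using insert.prems(5)[OF that] by (auto simp: set_eq_iff)
    then obtain z where z: "\<And>j. j \<in> insert n I \<Longrightarrow> z j \<in> S"
      "\<And>i j. j \<in> insert n I \<Longrightarrow> i \<in> insert n I \<Longrightarrow> i \<noteq> j \<Longrightarrow> z j \<in> A i"
      by (metis Diff_iff singletonD)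
    have zn: "z n \<in> K" using z insert.hyps by (auto simp: K_def)
    obtain j0 where j0: "j0 \<in> I" using insert.hyps by auto
    have zj: "z j \<in> S \<inter> A n" if "j \<in> I" for j using z that insert.hyps by auto
    have "compact K" "convex K" "compact (S \<inter> A n)" "convex (S \<inter> A n)"
      unfolding K_def using insert.prems
      by (auto intro!: compact_Int_closed closed_INT convex_Int convex_INT)
    moreover have "(S \<inter> A n) \<inter> K = {}" using empty by (auto simp: K_def)
    ultimately obtain a b where ab: "\<And>x. x \<in> S \<inter> A n \<Longrightarrow> inner a x < b" "\<And>x. x \<in> K \<Longrightarrow> b < inner a x"
      using compact_convex_strict_separation[of "S \<inter> A n" K] zn zj[OF j0] by blast
    define S' where "S' = S \<inter> {x. inner a x = b}"
    have "S' \<inter> (\<Inter>i\<in>I. A i) \<noteq> {}"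
    proof (rule insert.IH)
      show "compact S'" "convex S'"
        unfolding S'_def using insert.prems
        by (auto intro!: compact_Int_closed closed_hyperplane convex_Int convex_hyperplane)
      show "closed (A i) \<and> convex (A i)" if "i \<in> I" for i using insert.prems that by auto
      show "S' \<subseteq> (\<Union>i\<in>I. A i)"
        using insert.prems(4) ab(1) by (force simp: S'_def)
      fix j assume j: "j \<in> I"
      have lt: "inner a (z j) < b" "b < inner a (z n)" using ab zj[OF j] zn by auto
      \<comment> \<open>The parameter at which the segment from \<open>z j\<close> to \<open>z n\<close> crosses the hyperplane.\<close>
      define t where "t = (b - inner a (z j)) / (inner a (z n) - inner a (z j))"
      have t: "0 \<le> t" "t \<le> 1" using lt by (auto simp: t_def field_simps)
      let ?w = "(1 - t) *\<^sub>R z j + t *\<^sub>R z n"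
      have "inner a ?w = inner a (z j) + t * (inner a (z n) - inner a (z j))"
        by (simp add: inner_simps algebra_simps)
      also have "\<dots> = b" using lt by (simp add: t_def)
      finally have "inner a ?w = b" .
      moreover have "?w \<in> S" using insert.prems(3) z(1) j t by (intro convexD_alt) auto
      moreover have "?w \<in> A i" if "i \<in> I - {j}" for i
        using insert.prems(1) z(2) j t that insert.hyps by (intro convexD_alt) auto
      ultimately show "S' \<inter> (\<Inter>i\<in>I - {j}. A i) \<noteq> {}" by (auto simp: S'_def)
    qed
    then show False using ab(2) by (force simp: S'_def K_def)
  qed
qed

text \<open>
By induction all but any one of the sets meet in the hull of all the points, and the hull is covered,
so Klee's result applies. Convexity of the sets takes the place of Sperner's lemma or Brouwer's
fixed point theorem.
\<close>
lemma KKM_closed_convex: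
  fixes A :: "'i \<Rightarrow> 'a::real_inner set"
  assumes "finite I" "I \<noteq> {}"
    and "\<And>i. i \<in> I \<Longrightarrow> closed (A i) \<and> convex (A i)"
    and "\<And>J. J \<subseteq> I \<Longrightarrow> J \<noteq> {} \<Longrightarrow> convex hull (y ` J) \<subseteq> (\<Union>i\<in>J. A i)"
  shows "convex hull (y ` I) \<inter> (\<Inter>i\<in>I. A i) \<noteq> {}"
  using assms
proof (induction I rule: finite_psubset_induct)
  case (psubset I)
  show ?case
  proof (rule Klee_convex_cover)
    show "compact (convex hull (y ` I))" using psubset.hyps by (simp add: finite_imp_compact_convex_hull)
    fix j assume j: "j \<in> I"
    show "convex hull (y ` I) \<inter> (\<Inter>i\<in>I - {j}. A i) \<noteq> {}"
    proof (cases "I = {j}")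
      case False
      have "convex hull (y ` (I - {j})) \<inter> (\<Inter>i\<in>I - {j}. A i) \<noteq> {}"
      proof (rule psubset.IH)
        show "I - {j} \<subset> I" "I - {j} \<noteq> {}" using j False by auto
        show "closed (A i) \<and> convex (A i)" if "i \<in> I - {j}" for i
          using psubset.prems(2) that by blast
        show "convex hull (y ` J) \<subseteq> (\<Union>i\<in>J. A i)" if "J \<subseteq> I - {j}" "J \<noteq> {}" for J
          using psubset.prems(3) that by blast
      qed
      moreover have "convex hull (y ` (I - {j})) \<subseteq> convex hull (y ` I)" by (intro hull_mono) auto
      ultimately show ?thesis by blast
    qed simp
  qed (use psubset in auto)
qed

section \<open>Existence and uniqueness of the equilibrium\<close>

text \<open>
A point \<open>x\<close> outside all the sets satisfies \<open>f x y < 0\<close> for every \<open>y \<in> J\<close>, by contraposition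
of the monotonicity assumption; averaging over \<open>J\<close> gives \<open>f x x < 0\<close>.
\<close>
lemma pseudomonotone_sublevels_cover_hull:
  fixes f :: "'a::real_inner \<Rightarrow> 'a \<Rightarrow> real"
  assumes C: "convex C" and zero: "\<And>u. u \<in> C \<Longrightarrow> f u u = 0" and cv: "\<And>u. u \<in> C \<Longrightarrow> convex_on C (f u)"
    and spm: "\<And>u v. u \<in> C \<Longrightarrow> v \<in> C \<Longrightarrow> f u v \<ge> 0 \<Longrightarrow> f v u \<le> - \<gamma> * (norm (u - v))\<^sup>2"
    and J: "finite J" "J \<subseteq> C"
  shows "convex hull J \<subseteq> (\<Union>y\<in>J. {x \<in> C. f y x + \<gamma> * (norm (x - y))\<^sup>2 \<le> 0})"
proof
  fix x assume x: "x \<in> convex hull J"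
  have xC: "x \<in> C" using x hull_minimal[of J C convex] J(2) C by auto
  obtain w where w: "\<And>y. y \<in> J \<Longrightarrow> 0 \<le> w y" "sum w J = 1" "(\<Sum>y\<in>J. w y *\<^sub>R y) = x"
    using x J(1) by (auto simp: convex_hull_finite)
  have Jne: "J \<noteq> {}" using w(2) by auto
  show "x \<in> (\<Union>y\<in>J. {x \<in> C. f y x + \<gamma> * (norm (x - y))\<^sup>2 \<le> 0})"
  proof (rule ccontr)
    assume "\<not> ?thesis"
    then have *: "f y x + \<gamma> * (norm (x - y))\<^sup>2 > 0" if "y \<in> J" for y using that xC by auto
    have neg: "f x y < 0" if "y \<in> J" for y
      using spm[of x y] *[OF that] that J xC by (smt (verit) subsetD mult_minus_left)
    have "0 = f x (\<Sum>y\<in>J. w y *\<^sub>R y)" using zero xC w(3) by simp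
    also have "\<dots> \<le> (\<Sum>y\<in>J. w y * f x y)"
      using J Jne w xC cv by (intro convex_on_sum[where C=C]) auto
    also have "\<dots> < 0"
    proof -
      obtain y where y: "y \<in> J" "w y > 0"
        using w by (metis less_eq_real_def sum.neutral zero_neq_one)
      have "(\<Sum>y\<in>J. w y * f x y) < (\<Sum>y\<in>J. 0)"
      proof (rule sum_strict_mono_ex1)
        show "\<forall>y\<in>J. w y * f x y \<le> 0" using w neg by (simp add: mult_nonneg_nonpos less_imp_le)
        show "\<exists>y\<in>J. w y * f x y < 0" using y neg by (meson mult_pos_neg)
      qed (rule J)
      then show ?thesis by simp
    qed
    finally show False by simp
  qed
qed

text \<open>
At a point \<open>w\<close> of the segment from \<open>x\<close> to \<open>y\<close>, the convex function \<open>f w\<close> vanishes at \<open>w\<close> and is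
nonpositive at \<open>x\<close>, hence nonnegative at \<open>y\<close>. Hemicontinuity lets \<open>w\<close> tend to \<open>x\<close>.
\<close>
lemma Minty_equilibrium:
  fixes f :: "'a::real_normed_vector \<Rightarrow> 'a \<Rightarrow> real"
  assumes C: "convex C" and zero: "\<And>u. u \<in> C \<Longrightarrow> f u u = 0" and cv: "\<And>u. u \<in> C \<Longrightarrow> convex_on C (f u)"
    and hemi: "\<And>v. v \<in> C \<Longrightarrow> hemicontinuous_on C (\<lambda>u. f u v)"
    and x: "x \<in> C" and Minty: "\<And>y. y \<in> C \<Longrightarrow> f y x \<le> 0"
  shows "equilibrium_solution C f x"
  unfolding equilibrium_solution_def
proof (intro conjI ballI)
  show "x \<in> C" by (rule x)
  fix y assume y: "y \<in> C"
  have pos: "0 \<le> f (x + t *\<^sub>R (y - x)) y" if t: "0 < t" "t \<le> 1" for t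
  proof -
    let ?w = "x + t *\<^sub>R (y - x)"
    have weq: "?w = (1 - t) *\<^sub>R x + t *\<^sub>R y" by (simp add: algebra_simps)
    have w: "?w \<in> C" unfolding weq using C x y t by (intro convexD_alt) auto
    have "0 = f ?w ((1 - t) *\<^sub>R x + t *\<^sub>R y)" using zero[OF w] weq by simp
    also have "\<dots> \<le> (1 - t) * f ?w x + t * f ?w y"
      using convex_onD[OF cv[OF w]] x y t by simp
    also have "\<dots> \<le> t * f ?w y" using Minty[OF w] t by (simp add: mult_nonneg_nonpos)
    finally show ?thesis using t by (simp add: zero_le_mult_iff)
  qed
  have "continuous_on {0..1::real} (\<lambda>t. f (x + t *\<^sub>R (y - x)) y)"
    using hemi[OF y] x y by (simp add: hemicontinuous_on_def)
  then have "((\<lambda>t. f (x + t *\<^sub>R (y - x)) y) \<longlongrightarrow> f (x + 0 *\<^sub>R (y - x)) y) (at 0 within {0..1})"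
    unfolding continuous_on_def by (rule bspec) simp
  then have "((\<lambda>t. f (x + t *\<^sub>R (y - x)) y) \<longlongrightarrow> f (x + 0 *\<^sub>R (y - x)) y) (at_right 0)"
    by (simp add: at_within_Icc_at_right)
  moreover have "eventually (\<lambda>t. 0 \<le> f (x + t *\<^sub>R (y - x)) y) (at_right (0::real))"
    unfolding eventually_at_right_field using pos by (intro exI[of _ 1]) auto
  ultimately have "0 \<le> f (x + 0 *\<^sub>R (y - x)) y"
    by (rule tendsto_lowerbound) simp
  then show "0 \<le> f x y" by simp
qed

lemma strongly_pseudomonotone_equilibrium_exists:
  fixes f :: "'a::{real_inner, complete_space} \<Rightarrow> 'a \<Rightarrow> real"
  assumes "C \<noteq> {}" and C: "closed C" "convex C" and zero: "\<And>u. u \<in> C \<Longrightarrow> f u u = 0"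
    and cv: "\<And>u. u \<in> C \<Longrightarrow> convex_on C (f u)"
    and lsc: "\<And>u. u \<in> C \<Longrightarrow> lower_semicontinuous_on C (f u)"
    and hemi: "\<And>v. v \<in> C \<Longrightarrow> hemicontinuous_on C (\<lambda>u. f u v)"
    and \<gamma>: "\<gamma> > 0"
    and spm: "\<And>u v. u \<in> C \<Longrightarrow> v \<in> C \<Longrightarrow> f u v \<ge> 0 \<Longrightarrow> f v u \<le> - \<gamma> * (norm (u - v))\<^sup>2"
  shows "\<exists>p. equilibrium_solution C f p"
proof -
  define M where "M y = {x \<in> C. f y x + \<gamma> * (norm (x - y))\<^sup>2 \<le> 0}" for y
  have M: "closed (M y)" "convex (M y)" "bounded (M y)" if "y \<in> C" for y
    unfolding M_def using quadratically_perturbed_sublevel[OF C(1) cv[OF that] lsc[OF that] \<gamma>] by auto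
  have fip: "\<Inter>(M ` I) \<noteq> {}" if I: "finite I" "I \<subseteq> C" for I
  proof (cases "I = {}")
    case False
    have "convex hull ((\<lambda>y. y) ` I) \<inter> (\<Inter>y\<in>I. M y) \<noteq> {}"
    proof (rule KKM_closed_convex[OF I(1) False])
      show "closed (M y) \<and> convex (M y)" if "y \<in> I" for y using M that I by auto
      fix J assume "J \<subseteq> I"
      then have "finite J" "J \<subseteq> C" using I finite_subset by auto
      then show "convex hull ((\<lambda>y. y) ` J) \<subseteq> (\<Union>y\<in>J. M y)"
        unfolding M_def using pseudomonotone_sublevels_cover_hull[of C f \<gamma> J] C(2) zero cv spm by simp
    qed
    then show ?thesis by blast
  qed simp
  obtain y0 where y0: "y0 \<in> C" using assms(1) by auto
  have "\<Inter>(M ` C) \<noteq> {}"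
  proof (rule closed_convex_fip)
    show "M y0 \<in> M ` C" "bounded (M y0)" using y0 M by auto
    show "closed S \<and> convex S" if "S \<in> M ` C" for S using that M by auto
    show "\<Inter>\<G> \<noteq> {}" if "finite \<G>" "\<G> \<subseteq> M ` C" for \<G>
      using finite_subset_image[OF that] fip by blast
  qed
  then obtain p where p: "\<And>y. y \<in> C \<Longrightarrow> p \<in> M y" by auto
  have "equilibrium_solution C f p"
  proof (rule Minty_equilibrium[OF C(2) zero cv hemi])
    show "p \<in> C" using p y0 by (auto simp: M_def)
    fix y assume "y \<in> C"
    then have "f y p + \<gamma> * (norm (p - y))\<^sup>2 \<le> 0" using p by (simp add: M_def)
    moreover have "0 \<le> \<gamma> * (norm (p - y))\<^sup>2" using \<gamma> by simp
    ultimately show "f y p \<le> 0" by linarith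
  qed
  then show ?thesis by blast
qed

lemma strongly_pseudomonotone_equilibrium_unique:
  fixes f :: "'a::real_normed_vector \<Rightarrow> 'a \<Rightarrow> real"
  assumes \<gamma>: "\<gamma> > 0"
    and spm: "\<And>u v. u \<in> C \<Longrightarrow> v \<in> C \<Longrightarrow> f u v \<ge> 0 \<Longrightarrow> f v u \<le> - \<gamma> * (norm (u - v))\<^sup>2"
    and "equilibrium_solution C f p" "equilibrium_solution C f q"
  shows "p = q"
proof -
  have "0 \<le> f p q" "0 \<le> f q p" "p \<in> C" "q \<in> C" using assms by (auto simp: equilibrium_solution_def)
  with spm[of p q] have "\<gamma> * (norm (p - q))\<^sup>2 \<le> 0" by simp
  with \<gamma> show ?thesis by (simp add: mult_le_0_iff)
qed

section \<open>The golden ratio iteration\<close>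

lemma golden_ratio_props:
  "golden_ratio > 1" "golden_ratio\<^sup>2 = golden_ratio + 1"
proof -
  have "sqrt 5 > 1" by simp
  then show "golden_ratio > 1" by (simp add: golden_ratio_def)
  show "golden_ratio\<^sup>2 = golden_ratio + 1"
    by (simp add: golden_ratio_def power2_eq_square field_simps)
qed

text \<open>
The averaging step expresses \<open>w\<close> as a convex combination of \<open>x\<close> and \<open>xb\<close> with weights
\<open>2 - \<phi>\<close> and \<open>\<phi> - 1\<close>. Solved for the distance from \<open>x\<close> to \<open>p\<close>, the
resulting identity has coefficients that are linear in \<open>\<phi>\<close> because \<open>\<phi>\<^sup>2 = \<phi> + 1\<close>.
\<close>
lemma golden_averaging_norm:
  fixes p w xb x :: "'a::real_inner"
  assumes w: "w = ((golden_ratio - 1) *\<^sub>R x + xb) /\<^sub>R golden_ratio"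
  shows "(norm (x - p))\<^sup>2 = (golden_ratio + 1) * (norm (w - p))\<^sup>2 - golden_ratio * (norm (xb - p))\<^sup>2
    + (golden_ratio - 1) * (norm (x - xb))\<^sup>2"
proof -
  let ?\<phi> = golden_ratio
  note g = golden_ratio_props
  have w': "?\<phi> *\<^sub>R w = (?\<phi> - 1) *\<^sub>R x + xb" using g(1) by (simp add: w)
  have inv: "1 / ?\<phi> = ?\<phi> - 1" using g by (simp add: field_simps power2_eq_square)
  have "w - p = (1 - 1/?\<phi>) *\<^sub>R (x - p) + (1/?\<phi>) *\<^sub>R (xb - p)"
    using g(1) by (simp add: w algebra_simps divide_inverse)
  then have "(norm (w - p))\<^sup>2 = (1 - 1/?\<phi>) * (norm (x - p))\<^sup>2 + (1/?\<phi>) * (norm (xb - p))\<^sup>2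
      - (1/?\<phi>) * (1 - 1/?\<phi>) * (norm (x - xb))\<^sup>2"
    by (simp only: norm_sq_affine_comb) simp
  then have "(?\<phi> + 1) * (norm (w - p))\<^sup>2 = (?\<phi> + 1) * ((2 - ?\<phi>) * (norm (x - p))\<^sup>2 + (?\<phi> - 1) * (norm (xb - p))\<^sup>2
      - (?\<phi> - 1) * (2 - ?\<phi>) * (norm (x - xb))\<^sup>2)"
    by (simp add: inv)
  also have "\<dots> = ((?\<phi> + 1) * (2 - ?\<phi>)) * (norm (x - p))\<^sup>2 + ((?\<phi> + 1) * (?\<phi> - 1)) * (norm (xb - p))\<^sup>2
      - (?\<phi> - 1) * ((?\<phi> + 1) * (2 - ?\<phi>)) * (norm (x - xb))\<^sup>2"
    by (simp add: algebra_simps)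
  also have "(?\<phi> + 1) * (2 - ?\<phi>) = 1" using g(2) by (simp add: algebra_simps power2_eq_square)
  also have "(?\<phi> + 1) * (?\<phi> - 1) = ?\<phi>" using g(2) by (simp add: algebra_simps power2_eq_square)
  finally show ?thesis by simp
qed

text \<open>
Add the optimality condition of \<open>x2\<close> tested at \<open>p\<close> to that of \<open>x1\<close> tested at \<open>x2\<close>. In the
second one \<open>b0 - x1 = \<phi> *\<^sub>R (b1 - x1)\<close>, so after polarization \<open>(norm (x2 - b1))\<^sup>2\<close> appears with the
coefficient \<open>1 - \<phi>\<close>, which the averaging identity for \<open>(norm (x2 - p))\<^sup>2\<close> cancels.
The three values of \<open>f\<close> that do not involve \<open>p\<close> form a triangle to which the Lipschitz-type
condition applies, and \<open>f x1 p \<le> - \<gamma> * (norm (x1 - p))\<^sup>2\<close> because \<open>f p x1 \<ge> 0\<close>.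
\<close>
lemma golden_ratio_energy_inequality:
  fixes f :: "'a::{real_inner, complete_space} \<Rightarrow> 'a \<Rightarrow> real"
  assumes C: "C \<noteq> {}" "closed C"
    and cv: "\<And>u. u \<in> C \<Longrightarrow> convex_on C (f u)"
    and lsc: "\<And>u. u \<in> C \<Longrightarrow> lower_semicontinuous_on C (f u)"
    and spm: "\<And>u v. u \<in> C \<Longrightarrow> v \<in> C \<Longrightarrow> f u v \<ge> 0 \<Longrightarrow> f v u \<le> - \<gamma> * (norm (u - v))\<^sup>2"
    and Lip: "\<And>u v w. u \<in> C \<Longrightarrow> v \<in> C \<Longrightarrow> w \<in> C \<Longrightarrow>
      f u w - c * (norm (u - v))\<^sup>2 - c * (norm (v - w))\<^sup>2 \<le> f u v + f v w"
    and lam: "lam > 0" and p: "equilibrium_solution C f p" and x0: "x0 \<in> C"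
    and x1: "x1 = prox C lam (f x0) b0" and b1: "b1 = ((golden_ratio - 1) *\<^sub>R x1 + b0) /\<^sub>R golden_ratio"
    and x2: "x2 = prox C lam (f x1) b1" and b2: "b2 = ((golden_ratio - 1) *\<^sub>R x2 + b1) /\<^sub>R golden_ratio"
  shows "(golden_ratio + 1) * (norm (b2 - p))\<^sup>2 + (golden_ratio - 2 * lam * c) * (norm (x2 - x1))\<^sup>2
      + golden_ratio * (norm (x1 - b1))\<^sup>2 + 2 * lam * \<gamma> * (norm (x1 - p))\<^sup>2
    \<le> (golden_ratio + 1) * (norm (b1 - p))\<^sup>2 + 2 * lam * c * (norm (x1 - x0))\<^sup>2"
proof -
  let ?\<phi> = golden_ratio
  note g = golden_ratio_props
  note prox0 = prox_in_and_variational_ineq[OF C cv[OF x0] lsc[OF x0] lam, where z = b0, folded x1]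
  note x1C = prox0(1)
  note prox1 = prox_in_and_variational_ineq[OF C cv[OF x1C] lsc[OF x1C] lam, where z = b1, folded x2]
  note x2C = prox1(1)
  have pC: "p \<in> C" and sol: "\<And>y. y \<in> C \<Longrightarrow> f p y \<ge> 0"
    using p by (auto simp: equilibrium_solution_def)
  have A: "inner (b1 - x2) (p - x2) \<le> lam * (f x1 p - f x1 x2)" by (rule prox1(2)[OF pC])
  have B: "inner (b0 - x1) (x2 - x1) \<le> lam * (f x0 x2 - f x0 x1)" by (rule prox0(2)[OF x2C])
  have "b0 - x1 = ?\<phi> *\<^sub>R (b1 - x1)" using g(1) by (simp add: b1 algebra_simps)
  with B have B': "?\<phi> * inner (b1 - x1) (x2 - x1) \<le> lam * (f x0 x2 - f x0 x1)" by simp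
  have "lam * f x1 p \<le> lam * (- \<gamma> * (norm (x1 - p))\<^sup>2)"
    using spm[OF pC x1C sol[OF x1C]] lam
    by (intro mult_left_mono) (simp_all add: norm_minus_commute)
  moreover have "lam * (f x0 x2 - f x0 x1 - f x1 x2) \<le> lam * (c * (norm (x1 - x0))\<^sup>2 + c * (norm (x2 - x1))\<^sup>2)"
    using Lip[OF x0 x1C x2C] lam norm_minus_commute[of x0 x1] norm_minus_commute[of x1 x2]
    by (intro mult_left_mono) (simp_all add: algebra_simps)
  ultimately have S: "inner (b1 - x2) (p - x2) + ?\<phi> * inner (b1 - x1) (x2 - x1)
    \<le> lam * (- \<gamma> * (norm (x1 - p))\<^sup>2) + lam * (c * (norm (x1 - x0))\<^sup>2 + c * (norm (x2 - x1))\<^sup>2)"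
    using A B' by (simp add: algebra_simps)
  have I1: "2 * inner (b1 - x2) (p - x2) = (norm (x2 - b1))\<^sup>2 + (norm (x2 - p))\<^sup>2 - (norm (b1 - p))\<^sup>2"
    unfolding power2_norm_eq_inner by (simp add: inner_simps inner_commute)
  have I2: "2 * inner (b1 - x1) (x2 - x1) = (norm (x1 - b1))\<^sup>2 + (norm (x2 - x1))\<^sup>2 - (norm (x2 - b1))\<^sup>2"
    unfolding power2_norm_eq_inner by (simp add: inner_simps inner_commute)
  have "2 * inner (b1 - x2) (p - x2) + ?\<phi> * (2 * inner (b1 - x1) (x2 - x1))
    \<le> - 2 * lam * \<gamma> * (norm (x1 - p))\<^sup>2 + 2 * lam * c * (norm (x1 - x0))\<^sup>2 + 2 * lam * c * (norm (x2 - x1))\<^sup>2"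
    using S by (simp add: algebra_simps)
  then show ?thesis
    unfolding I1 I2 golden_averaging_norm[OF b2, of p] by (simp add: algebra_simps)
qed

text \<open>
The rate for the norms is \<open>sqrt \<rho>\<close>. The terms before index \<open>m\<close>, from which on the energy
decreases, are absorbed into the constant.
\<close>
lemma geometric_decay_of_squares:
  fixes x :: "nat \<Rightarrow> 'a::real_normed_vector"
  assumes \<rho>: "0 < \<rho>" "\<rho> < 1" and k: "k > 0"
    and dec: "\<And>n. n \<ge> m \<Longrightarrow> E (Suc n) \<le> \<rho> * E n"
    and bound: "\<And>n. n \<ge> m \<Longrightarrow> k * (norm (x n - l))\<^sup>2 \<le> E n"
  shows "converges_R_linearly x l"
proof -
  define \<theta> where "\<theta> = sqrt \<rho>"
  have \<theta>: "0 < \<theta>" "\<theta> < 1" "\<theta>\<^sup>2 = \<rho>" using \<rho> by (auto simp: \<theta>_def)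
  have E: "E n \<le> \<rho> ^ (n - m) * E m" if "n \<ge> m" for n
    using that
  proof (induction n rule: dec_induct)
    case (step n)
    have "E (Suc n) \<le> \<rho> * (\<rho> ^ (n - m) * E m)"
      using dec[of n] step \<rho> mult_left_mono[OF step.IH, of \<rho>] by linarith
    then show ?case using step by (simp add: Suc_diff_le)
  qed simp
  have Em: "E m \<ge> 0" using bound[of m] k by (smt (verit) mult_nonneg_nonneg zero_le_power2 order_refl)
  define M1 where "M1 = sqrt (E m / (k * \<rho> ^ m))"
  \<comment> \<open>The summand \<open>1\<close> keeps the constant positive when the other two vanish.\<close>
  define M where "M = 1 + M1 + (\<Sum>n<m. norm (x n - l) / \<theta> ^ n)"
  have M1: "M1 \<ge> 0" using Em k \<rho> by (simp add: M1_def)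
  have S0: "0 \<le> (\<Sum>n<m. norm (x n - l) / \<theta> ^ n)" using \<theta> by (intro sum_nonneg) auto
  have "norm (x n - l) \<le> M * \<theta> ^ n" for n
  proof (cases "n < m")
    case True
    then have "norm (x n - l) / \<theta> ^ n \<le> (\<Sum>n<m. norm (x n - l) / \<theta> ^ n)"
      using \<theta> by (intro member_le_sum) auto
    then have "norm (x n - l) / \<theta> ^ n \<le> M" using M1 by (simp add: M_def)
    then show ?thesis using \<theta> by (simp add: field_simps)
  next
    case False
    then have n: "n \<ge> m" by simp
    have "k * (norm (x n - l))\<^sup>2 \<le> \<rho> ^ (n - m) * E m"
      using bound[OF n] E[OF n] by linarith
    then have "(norm (x n - l))\<^sup>2 \<le> (E m / (k * \<rho> ^ m)) * \<rho> ^ n"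
      using k \<rho> n by (simp add: power_diff field_simps)
    also have "\<dots> = (M1 * \<theta> ^ n)\<^sup>2"
      using Em k \<rho> \<theta>(3) by (simp add: M1_def power_mult_distrib flip: power_mult) (simp add: power_mult mult.commute[of n])
    finally have "norm (x n - l) \<le> M1 * \<theta> ^ n"
      using M1 \<theta> by (auto intro: power2_le_imp_le)
    also have "\<dots> \<le> M * \<theta> ^ n" using S0 \<theta> by (intro mult_right_mono) (auto simp: M_def)
    finally show ?thesis .
  qed
  moreover have "M > 0" using M1 S0 by (simp add: M_def)
  ultimately show ?thesis
    unfolding converges_R_linearly_def using \<theta> by blast
qed


theorem theorem1:
  fixes C :: "'a::{real_inner, complete_space} set"
    and f :: "'a \<Rightarrow> 'a \<Rightarrow> real"
    and c1 c2 lam :: real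
    and x xbar :: "nat \<Rightarrow> 'a"
  assumes "C \<noteq> {}" and "closed C" and "convex C"
    and "\<forall>u\<in>C. f u u = 0"
    and "\<forall>u\<in>C. convex_on C (f u) \<and> lower_semicontinuous_on C (f u)"
    and "\<forall>v\<in>C. hemicontinuous_on C (\<lambda>u. f u v)"
    and strongly_pseudomonotone:
      "\<exists>\<gamma>>0. \<forall>u\<in>C. \<forall>v\<in>C. f u v \<ge> 0 \<longrightarrow> f v u \<le> - \<gamma> * (norm (u - v))\<^sup>2"
    and "c1 > 0" and "c2 > 0"
    and Lipschitz_type:
      "\<forall>u\<in>C. \<forall>v\<in>C. \<forall>w\<in>C.
         f u v + f v w \<ge> f u w - c1 * (norm (u - v))\<^sup>2 - c2 * (norm (v - w))\<^sup>2"
    and "0 < lam" and "lam < golden_ratio / (4 * max c1 c2)"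
    and "x 1 \<in> C"
    and "\<forall>n\<ge>1. xbar n = ((golden_ratio - 1) *\<^sub>R x n + xbar (n - 1)) /\<^sub>R golden_ratio"
    and "\<forall>n\<ge>1. x (n + 1) = prox C lam (f (x n)) (xbar n)"
  shows "(\<exists>!xd. equilibrium_solution C f xd) \<and>
         converges_R_linearly x (THE xd. equilibrium_solution C f xd)"
proof -
  note C = \<open>C \<noteq> {}\<close> \<open>closed C\<close> and lam = \<open>0 < lam\<close>
  have zero: "\<And>u. u \<in> C \<Longrightarrow> f u u = 0" and cv: "\<And>u. u \<in> C \<Longrightarrow> convex_on C (f u)"
    and lsc: "\<And>u. u \<in> C \<Longrightarrow> lower_semicontinuous_on C (f u)"
    and hemi: "\<And>v. v \<in> C \<Longrightarrow> hemicontinuous_on C (\<lambda>u. f u v)"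
    using assms by auto
  obtain \<gamma> where \<gamma>: "\<gamma> > 0"
    and spm: "\<And>u v. u \<in> C \<Longrightarrow> v \<in> C \<Longrightarrow> f u v \<ge> 0 \<Longrightarrow> f v u \<le> - \<gamma> * (norm (u - v))\<^sup>2"
    using strongly_pseudomonotone by blast
  obtain p where p: "equilibrium_solution C f p"
    using strongly_pseudomonotone_equilibrium_exists[OF C \<open>convex C\<close> zero cv lsc hemi \<gamma> spm] by blast
  have unique: "q = p" if "equilibrium_solution C f q" for q
    using strongly_pseudomonotone_equilibrium_unique[OF \<gamma> spm that p] .
  define c where "c = max c1 c2"
  define \<kappa> where "\<kappa> = 2 * lam * c"
  let ?\<phi> = golden_ratio
  have c: "c > 0" "c1 \<le> c" "c2 \<le> c" using \<open>c1 > 0\<close> by (auto simp: c_def)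
  have \<kappa>: "0 < \<kappa>" "\<kappa> < ?\<phi> - \<kappa>"
  proof -
    show "0 < \<kappa>" using lam c by (simp add: \<kappa>_def)
    show "\<kappa> < ?\<phi> - \<kappa>"
      using assms(12) c by (simp add: \<kappa>_def field_simps flip: c_def)
  qed
  have Lip: "f u w - c * (norm (u - v))\<^sup>2 - c * (norm (v - w))\<^sup>2 \<le> f u v + f v w"
    if "u \<in> C" "v \<in> C" "w \<in> C" for u v w
  proof -
    have "c1 * (norm (u - v))\<^sup>2 \<le> c * (norm (u - v))\<^sup>2" "c2 * (norm (v - w))\<^sup>2 \<le> c * (norm (v - w))\<^sup>2"
      using c by (auto intro: mult_right_mono)
    then show ?thesis using Lipschitz_type that by fastforce
  qed
  have xbar: "xbar (Suc n) = ((?\<phi> - 1) *\<^sub>R x (Suc n) + xbar n) /\<^sub>R ?\<phi>" for n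
    using assms(14) by force
  have x_Suc: "x (Suc n) = prox C lam (f (x n)) (xbar n)" if "n \<ge> 1" for n
    using assms(15) that by simp
  have xC: "x n \<in> C" if "n \<ge> 1" for n
    using that
  proof (induction n rule: dec_induct)
    case (step n)
    then show ?case
      using prox_in_and_variational_ineq(1)[OF C cv lsc lam] x_Suc by simp
  qed (rule \<open>x 1 \<in> C\<close>)
  define a where "a n = (?\<phi> + 1) * (norm (xbar n - p))\<^sup>2" for n
  define b where "b n = (norm (x n - x (n - 1)))\<^sup>2" for n
  define E where "E n = a n + (?\<phi> - \<kappa>) * b n" for n
  \<comment> \<open>The index starts at \<open>2\<close>: only from there on is \<open>x n\<close> itself the result of a proximal step.\<close>
  have energy: "a (Suc n) + (?\<phi> - \<kappa>) * b (Suc n)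
      + ?\<phi> * (norm (x n - xbar n))\<^sup>2 + 2 * lam * \<gamma> * (norm (x n - p))\<^sup>2 \<le> a n + \<kappa> * b n"
    if n: "n \<ge> 2" for n
  proof -
    obtain m where m: "n = Suc m" "m \<ge> 1" using n by (cases n) auto
    show ?thesis
      using golden_ratio_energy_inequality[OF C cv lsc spm Lip lam p xC[OF m(2)] x_Suc[OF m(2)] xbar x_Suc xbar] m
      unfolding a_def b_def \<kappa>_def by simp
  qed
  define \<mu> where "\<mu> = min ?\<phi> (2 * lam * \<gamma>)"
  \<comment> \<open>The minimum with \<open>1 / 2\<close> keeps the contraction factor \<open>1 - \<epsilon>\<close> positive.\<close>
  define \<epsilon> where "\<epsilon> = min (1/2) (\<mu> / (2 * (?\<phi> + 1)))"
  have \<phi>: "?\<phi> > 1" by (rule golden_ratio_props)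
  have \<mu>: "\<mu> > 0" "\<mu> \<le> ?\<phi>" "\<mu> \<le> 2 * lam * \<gamma>" using lam \<gamma> \<phi> by (auto simp: \<mu>_def)
  have \<epsilon>: "0 < \<epsilon>" "\<epsilon> < 1" "\<epsilon> * (?\<phi> + 1) \<le> \<mu> / 2"
  proof -
    have "\<epsilon> \<le> \<mu> / (2 * (?\<phi> + 1))" by (simp add: \<epsilon>_def)
    then show "\<epsilon> * (?\<phi> + 1) \<le> \<mu> / 2" using \<phi> by (simp add: field_simps)
  qed (use \<mu> \<phi> in \<open>auto simp: \<epsilon>_def\<close>)
  define \<rho> where "\<rho> = max (1 - \<epsilon>) (\<kappa> / (?\<phi> - \<kappa>))"
  have \<rho>: "0 < \<rho>" "\<rho> < 1" "1 - \<epsilon> \<le> \<rho>" "\<kappa> \<le> \<rho> * (?\<phi> - \<kappa>)"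
  proof -
    have "\<kappa> / (?\<phi> - \<kappa>) \<le> \<rho>" by (simp add: \<rho>_def)
    then show "\<kappa> \<le> \<rho> * (?\<phi> - \<kappa>)" using \<kappa> by (simp add: pos_divide_le_eq)
  qed (use \<epsilon> \<kappa> in \<open>auto simp: \<rho>_def less_max_iff_disj\<close>)
  have nonneg: "a n \<ge> 0" "b n \<ge> 0" for n using \<phi> by (auto simp: a_def b_def)
  have gain: "\<epsilon> * a n \<le> ?\<phi> * (norm (x n - xbar n))\<^sup>2 + 2 * lam * \<gamma> * (norm (x n - p))\<^sup>2" for n
  proof -
    let ?u = "norm (x n - xbar n)" and ?v = "norm (x n - p)"
    have "norm (xbar n - p) \<le> ?u + ?v"
      using norm_triangle_ineq4[of "x n - p" "x n - xbar n"] by (simp add: add.commute)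
    then have "(norm (xbar n - p))\<^sup>2 \<le> (?u + ?v)\<^sup>2" by (intro power_mono) auto
    also have "\<dots> \<le> 2 * (?u\<^sup>2 + ?v\<^sup>2)"
      using sum_squares_bound[of ?u ?v] by (simp add: power2_sum)
    finally have sq: "(norm (xbar n - p))\<^sup>2 \<le> 2 * (?u\<^sup>2 + ?v\<^sup>2)" .
    have "\<epsilon> * a n = (\<epsilon> * (?\<phi> + 1)) * (norm (xbar n - p))\<^sup>2" by (simp add: a_def)
    also have "\<dots> \<le> (\<mu> / 2) * (2 * (?u\<^sup>2 + ?v\<^sup>2))"
      using \<epsilon> \<mu> sq by (intro mult_mono) auto
    also have "\<dots> = \<mu> * ?u\<^sup>2 + \<mu> * ?v\<^sup>2" by (simp add: algebra_simps)
    also have "\<dots> \<le> ?\<phi> * ?u\<^sup>2 + 2 * lam * \<gamma> * ?v\<^sup>2"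
      using \<mu> by (intro add_mono mult_right_mono) auto
    finally show ?thesis .
  qed
  have "converges_R_linearly x p"
  proof (rule geometric_decay_of_squares[OF \<rho>(1,2)])
    show "2 * lam * \<gamma> > 0" using lam \<gamma> by simp
    fix n :: nat assume n: "2 \<le> n"
    have "a (Suc n) + (?\<phi> - \<kappa>) * b (Suc n) \<le> (1 - \<epsilon>) * a n + \<kappa> * b n"
      using energy[OF n] gain[of n] by (simp add: algebra_simps)
    also have "\<dots> \<le> \<rho> * a n + (\<rho> * (?\<phi> - \<kappa>)) * b n"
      using \<rho> nonneg by (intro add_mono mult_right_mono) auto
    finally show "E (Suc n) \<le> \<rho> * E n" by (simp add: E_def algebra_simps)
    have "0 \<le> (?\<phi> - \<kappa>) * b (Suc n)" "\<kappa> * b n \<le> (?\<phi> - \<kappa>) * b n" "0 \<le> ?\<phi> * (norm (x n - xbar n))\<^sup>2"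
      using nonneg \<kappa> \<phi> by (auto intro: mult_right_mono)
    then show "2 * lam * \<gamma> * (norm (x n - p))\<^sup>2 \<le> E n"
      using energy[OF n] nonneg(1)[of "Suc n"] unfolding E_def by linarith
  qed
  moreover have "(THE xd. equilibrium_solution C f xd) = p"
    using p unique by (rule the_equality)
  ultimately have "converges_R_linearly x (THE xd. equilibrium_solution C f xd)" by simp
  moreover have "\<exists>!xd. equilibrium_solution C f xd" using p unique by (rule ex1I)
  ultimately show ?thesis by blast
qed

end
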